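(* Let $k$ be a positive integer, let $I\subset\mathbb{R}$ be an open interval, and let $\gamma:I\to\mathbb{L}^3$ be a spacelike curve with non-zero curvature vector, parametrized by arclength, which is of type $L_k$ at $s_0\in I$. Let $\tau(s)$ be its torsion function, defined for $s\neq s_0$ near $s_0$. Then $$\lim_{s\to s_0}(s-s_0)\,\tau(s)=-\frac{1}{2}\,k .$$ In particular, $\tau(s)$ is unbounded at $s_0$.
   Context: $\mathbb{L}^3$ is $\mathbb{R}^3$ with the inner product $\langle \boldsymbol{x},\boldsymbol{x}\rangle=x^2+y^2-z^2$ for $\boldsymbol{x}=(x,y,z)^T$. A vector $\boldsymbol{x}$ is spacelike if $\langle\boldsymbol{x},\boldsymbol{x}\rangle>0$ or $\boldsymbol{x}=\boldsymbol{0}$, timelike if $\langle\boldsymbol{x},\boldsymbol{x}\rangle<0$, and lightlike if $\boldsymbol{x}\neq\boldsymbol{0}$ and $\langle\boldsymbol{x},\boldsymbol{x}\rangle=0$. The vector product is $\boldsymbol{v}\times\boldsymbol{w}:=Z(\boldsymbol{v}\times_{\mathrm e}\boldsymbol{w})$, where $Z=\mathrm{diag}(1,1,-1)$ and $\times_{\mathrm e}$ is the standard Euclidean cross product. All curves are smooth. A regular curve is spacelike if each of its tangent vectors is spacelike. For a unit speed spacelike curve $\gamma:I\to\mathbb{L}^3$ ($\langle\gamma',\gamma'\rangle=1$), set $\boldsymbol{e}:=\gamma'$, $\boldsymbol{\kappa}:=\gamma''$ (curvature vector field), and $\theta:=\langle\boldsymbol{\kappa},\boldsymbol{\kappa}\rangle$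 (causal curvature function). The curve has non-zero curvature vector if $\boldsymbol{\kappa}$ vanishes nowhere. For a positive integer $k$, a curve with non-zero curvature vector is of type $L_k$ at $s_0$ if $\theta(s_0)=\cdots=\theta^{(k-1)}(s_0)=0$ and $\theta^{(k)}(s_0)\neq0$. Then $\boldsymbol{\kappa}(s_0)$ is lightlike, and $\theta(s)\neq0$ for $s\ne s_0$ near $s_0$. Torsion: on an interval where $\theta\neq0$, put $\kappa:=\sqrt{|\theta|}$, $\sigma_\gamma:=-1$ if $\theta>0$ and $\sigma_\gamma:=+1$ if $\theta<0$, $\boldsymbol{n}:=\boldsymbol{\kappa}/\kappa$, $\boldsymbol{b}:=\sigma_\gamma\,\boldsymbol{e}\times\boldsymbol{n}$, and define the torsion function $\tau:=\langle\boldsymbol{n}',\boldsymbol{b}\rangle$.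
   Formalization: The sign of the printed limit depends on orientation (reversing s flips it): the formal theorem gives −k/2 when e×κ = κ at s_0 and +k/2 when e×κ = −κ at s_0, one of which always holds; τ is unbounded in both cases. *)

theory Defs
  imports "HOL-Analysis.Analysis"
begin

section \<open>Lorentz--Minkowski 3-space\<close>

definition lor :: "real^3 \<Rightarrow> real^3 \<Rightarrow> real" where
  "lor x y = x$1 * y$1 + x$2 * y$2 - x$3 * y$3"

definition spacelike :: "real^3 \<Rightarrow> bool" where
  "spacelike x \<longleftrightarrow> lor x x > 0 \<or> x = 0"

definition Zmat :: "real^3^3" where
  "Zmat = (\<chi> i j. if i = j then (if i = 3 then -1 else 1) else 0)"

definition lor_cross :: "real^3 \<Rightarrow> real^3 \<Rightarrow> real^3" where
  "lor_cross v w = Zmat *v cross3 v w"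


section \<open>Curves\<close>

text \<open>A curve on an open interval \<open>I\<close> is a total function of which only the values on \<open>I\<close>
  matter: since \<open>I\<close> is open, derivatives at points of \<open>I\<close> depend only on these values.\<close>

definition vderiv :: "(real \<Rightarrow> real^3) \<Rightarrow> real \<Rightarrow> real^3" where
  "vderiv f s = vector_derivative f (at s)"

definition smooth_curve_on :: "real set \<Rightarrow> (real \<Rightarrow> real^3) \<Rightarrow> bool" where
  "smooth_curve_on I \<gamma> \<longleftrightarrow> (\<forall>n. \<forall>s\<in>I. (vderiv ^^ n) \<gamma> differentiable (at s))"

definition regular_curve_on :: "real set \<Rightarrow> (real \<Rightarrow> real^3) \<Rightarrow> bool" where
  "regular_curve_on I \<gamma> \<longleftrightarrow> (\<forall>s\<in>I. vderiv \<gamma> s \<noteq> 0)"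

definition spacelike_curve_on :: "real set \<Rightarrow> (real \<Rightarrow> real^3) \<Rightarrow> bool" where
  "spacelike_curve_on I \<gamma> \<longleftrightarrow> regular_curve_on I \<gamma> \<and> (\<forall>s\<in>I. spacelike (vderiv \<gamma> s))"

definition arclength_param_on :: "real set \<Rightarrow> (real \<Rightarrow> real^3) \<Rightarrow> bool" where
  "arclength_param_on I \<gamma> \<longleftrightarrow> (\<forall>s\<in>I. lor (vderiv \<gamma> s) (vderiv \<gamma> s) = 1)"

definition tangent :: "(real \<Rightarrow> real^3) \<Rightarrow> real \<Rightarrow> real^3" where
  "tangent \<gamma> = vderiv \<gamma>"

definition curv_vec :: "(real \<Rightarrow> real^3) \<Rightarrow> real \<Rightarrow> real^3" where
  "curv_vec \<gamma> = vderiv (vderiv \<gamma>)"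

definition causal_curv :: "(real \<Rightarrow> real^3) \<Rightarrow> real \<Rightarrow> real" where
  "causal_curv \<gamma> s = lor (curv_vec \<gamma> s) (curv_vec \<gamma> s)"

definition nonzero_curv_on :: "real set \<Rightarrow> (real \<Rightarrow> real^3) \<Rightarrow> bool" where
  "nonzero_curv_on I \<gamma> \<longleftrightarrow> (\<forall>s\<in>I. curv_vec \<gamma> s \<noteq> 0)"

definition type_L :: "nat \<Rightarrow> (real \<Rightarrow> real^3) \<Rightarrow> real \<Rightarrow> bool" where
  "type_L k \<gamma> s0 \<longleftrightarrow>
     (\<forall>i<k. (deriv ^^ i) (causal_curv \<gamma>) s0 = 0) \<and> (deriv ^^ k) (causal_curv \<gamma>) s0 \<noteq> 0"


section \<open>Torsion\<close>

text \<open>The following are meaningful only at parameters where \<^term>\<open>causal_curv \<gamma>\<close> does not vanish.\<close>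

definition curvature :: "(real \<Rightarrow> real^3) \<Rightarrow> real \<Rightarrow> real" where
  "curvature \<gamma> s = sqrt \<bar>causal_curv \<gamma> s\<bar>"

definition curve_sign :: "(real \<Rightarrow> real^3) \<Rightarrow> real \<Rightarrow> real" where
  "curve_sign \<gamma> s = (if causal_curv \<gamma> s > 0 then -1 else 1)"

definition normal_vec :: "(real \<Rightarrow> real^3) \<Rightarrow> real \<Rightarrow> real^3" where
  "normal_vec \<gamma> s = (1 / curvature \<gamma> s) *\<^sub>R curv_vec \<gamma> s"

definition binormal_vec :: "(real \<Rightarrow> real^3) \<Rightarrow> real \<Rightarrow> real^3" where
  "binormal_vec \<gamma> s = curve_sign \<gamma> s *\<^sub>R lor_cross (tangent \<gamma> s) (normal_vec \<gamma> s)"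

definition torsion :: "(real \<Rightarrow> real^3) \<Rightarrow> real \<Rightarrow> real" where
  "torsion \<gamma> s = lor (vderiv (normal_vec \<gamma>) s) (binormal_vec \<gamma> s)"

text \<open>Pitfall: the torsion is orientation-dependent. If \<open>\<kappa>(s0)\<close> is lightlike and \<open>e\<close> is the
  unit tangent there, then \<open>e \<times> \<kappa>(s0)\<close> is either \<open>\<kappa>(s0)\<close> or \<open>-\<kappa>(s0)\<close>. Reversing the
  parameter, or applying an orientation-reversing isometry, exchanges the two cases and changes the
  sign of \<open>(s - s0) \<tau>(s)\<close>; the first case is the one where the limit at a point of
  type \<open>L\<^sub>k\<close> is \<open>-k/2\<close>.\<close>

definition torsion_unbounded_at :: "real set \<Rightarrow> (real \<Rightarrow> real^3) \<Rightarrow> real \<Rightarrow> bool" where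
  "torsion_unbounded_at I \<gamma> s0 \<longleftrightarrow>
     (\<forall>\<delta>>0. \<not> bounded (torsion \<gamma> ` {s \<in> I. s \<noteq> s0 \<and> \<bar>s - s0\<bar> < \<delta> \<and> causal_curv \<gamma> s \<noteq> 0}))"

end

theory Submission
  imports Defs
begin

text \<open>
  Write \<open>e\<close> for the unit tangent, \<open>v\<close> for the curvature vector, \<open>\<theta> = \<langle>v, v\<rangle>\<close> and \<open>J w = e \<times> w\<close>.
  Differentiating \<open>n = v / sqrt \<bar>\<theta>\<bar>\<close> produces a multiple of \<open>v\<close>, which is orthogonal to
  \<open>J v\<close>, and the sign in the binormal turns \<open>\<bar>\<theta>\<bar>\<close> into \<open>- \<theta>\<close>, so that
  \<open>\<tau> = - \<langle>v', J v\<rangle> / \<theta>\<close> (lemma \<open>torsion_eq\<close>).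

  On the Lorentzian plane orthogonal to \<open>e\<close> the map \<open>J\<close> is an involution whose eigenspaces, for
  the eigenvalues \<open>1\<close> and \<open>-1\<close>, are the two lightlike lines. At \<open>s0\<close> the vector \<open>v\<close> is lightlike,
  hence \<open>J v = \<epsilon> v\<close> there with \<open>\<epsilon> = 1\<close> or \<open>\<epsilon> = -1\<close>. Split \<open>v\<close> along the two lines:
  \<open>\<theta>\<close> is twice the product of the two parts, and \<open>J v - \<epsilon> v\<close> is \<open>- 2 \<epsilon>\<close> times the part that vanishes at
  \<open>s0\<close>. The other part stays away from zero, so \<open>J v - \<epsilon> v\<close> is \<open>\<theta>\<close> times something bounded
  near \<open>s0\<close> (lemma \<open>lor_cross_near_eigenvector\<close>, with an explicit quotient).
  As \<open>\<langle>v', v\<rangle> = \<theta>' / 2\<close>, this gives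
  \<open>\<tau> = - \<epsilon> \<theta>' / (2 \<theta>) - R\<close> with \<open>R\<close> convergent at \<open>s0\<close>.

  Finally \<open>\<theta>\<close> has a zero of order exactly \<open>k\<close>, so \<open>(s - s0) \<theta>' / \<theta>\<close> tends to \<open>k\<close>
  (lemma \<open>finite_order_zero_log_derivative\<close>), and \<open>(s - s0) \<tau>\<close> tends to \<open>- \<epsilon> k / 2\<close>. The limit being
  nonzero, \<open>\<tau>\<close> cannot be bounded near \<open>s0\<close>.
\<close>

section \<open>Lorentzian algebra at a single parameter\<close>

lemma lor_cross_components:
  "lor_cross v w $ 1 = v$2 * w$3 - v$3 * w$2"
  "lor_cross v w $ 2 = v$3 * w$1 - v$1 * w$3"
  "lor_cross v w $ 3 = v$2 * w$1 - v$1 * w$2"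
  by (simp_all add: lor_cross_def Zmat_def cross3_def matrix_vector_mult_def sum_3)

lemma lor_commute: "lor x y = lor y x"
  by (simp add: lor_def)

lemma lor_add_left: "lor (x + y) z = lor x z + lor y z"
  by (simp add: lor_def algebra_simps)

lemma lor_diff_right: "lor x (y - z) = lor x y - lor x z"
  by (simp add: lor_def algebra_simps)

lemma lor_scaleR_left: "lor (a *\<^sub>R x) y = a * lor x y"
  by (simp add: lor_def algebra_simps)

lemma lor_scaleR_right: "lor x (a *\<^sub>R y) = a * lor x y"
  by (simp add: lor_def algebra_simps)

lemma lor_cross_scaleR_right: "lor_cross v (a *\<^sub>R w) = a *\<^sub>R lor_cross v w"
  by (simp add: vec_eq_iff forall_3 lor_cross_components algebra_simps)

lemma lor_lor_cross_self: "lor w (lor_cross v w) = 0"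
  by (simp add: lor_def lor_cross_components algebra_simps)

text \<open>For a unit spacelike \<open>e\<close>, let \<open>t = (0, 0, 1) + e$3 e\<close> be the projection of the time axis to
  the plane orthogonal to \<open>e\<close>. The vector below is \<open>t - \<epsilon> (e \<times> t)\<close>. For \<open>\<epsilon> = 1\<close> or \<open>\<epsilon> = -1\<close> it spans
  the eigenspace of \<open>e \<times> _\<close> for \<open>- \<epsilon>\<close>, and it depends polynomially on \<open>e\<close>, so it can serve as a
  continuous lightlike frame along a curve.\<close>

definition null_dir :: "real \<Rightarrow> real^3 \<Rightarrow> real^3" where
  "null_dir \<epsilon> e = vector [e$1 * e$3 - \<epsilon> * e$2, e$2 * e$3 + \<epsilon> * e$1, 1 + e$3 * e$3]"

text \<open>The projection \<open>t\<close> of the time axis has \<open>\<langle>t, t\<rangle> = - (1 + (e$3)\<^sup>2)\<close>, which never vanishes. So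
  \<open>t\<close> and \<open>e \<times> t\<close> form an orthogonal basis of the plane orthogonal to \<open>e\<close>, and
  \<open>N v = v$3 t + B (e \<times> t)\<close>, \<open>N (e \<times> v) = B t + v$3 (e \<times> t)\<close>; note \<open>e \<times> t = (e$2, - e$1, 0)\<close>.\<close>

lemma orthogonal_decomposition:
  assumes "lor e e = 1" and "lor e v = 0"
  defines "N \<equiv> 1 + e$3 * e$3" and "B \<equiv> lor_cross e v $ 3"
  shows "N * v$1 = v$3 * (e$1 * e$3) + B * e$2"
    and "N * v$2 = v$3 * (e$2 * e$3) - B * e$1"
    and "N * lor v v = B * B - v$3 * v$3"
    and "N * lor_cross e v $ 1 = B * (e$1 * e$3) + v$3 * e$2"
    and "N * lor_cross e v $ 2 = B * (e$2 * e$3) - v$3 * e$1"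
proof -
  have N: "N = e$1 * e$1 + e$2 * e$2"
    using assms(1) by (simp add: N_def lor_def)
  have o: "v$3 * e$3 = e$1 * v$1 + e$2 * v$2"
    using assms(2) by (simp add: lor_def)
  show 1: "N * v$1 = v$3 * (e$1 * e$3) + B * e$2"
    using o unfolding N B_def lor_cross_components by algebra
  show 2: "N * v$2 = v$3 * (e$2 * e$3) - B * e$1"
    using o unfolding N B_def lor_cross_components by algebra
  show "N * lor v v = B * B - v$3 * v$3"
    using o N N_def unfolding B_def lor_cross_components lor_def by algebra
  show "N * lor_cross e v $ 1 = B * (e$1 * e$3) + v$3 * e$2"
    using 2 N_def unfolding B_def lor_cross_components by algebra
  show "N * lor_cross e v $ 2 = B * (e$2 * e$3) - v$3 * e$1"
    using 1 N_def unfolding B_def lor_cross_components by algebra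
qed

text \<open>The difference \<open>e \<times> v - \<epsilon> v\<close> lies in the eigenspace for \<open>- \<epsilon>\<close>, because \<open>e \<times> _\<close> is an involution
  on the plane orthogonal to \<open>e\<close>; hence it is a multiple of \<open>null_dir \<epsilon> e\<close>. The coefficient is a
  linear factor of \<open>\<langle>v, v\<rangle>\<close>, and the factor on the left-hand side is the complementary one.
  Where that factor is nonzero, the difference is thus divisible by \<open>\<langle>v, v\<rangle>\<close>.\<close>

lemma lor_cross_near_eigenvector:
  assumes "lor e e = 1" and "lor e v = 0" and "\<epsilon> * \<epsilon> = 1"
  shows "(lor_cross e v $ 3 + \<epsilon> * v$3) *\<^sub>R (lor_cross e v - \<epsilon> *\<^sub>R v) = lor v v *\<^sub>R null_dir \<epsilon> e"
proof -
  define N where "N = 1 + e$3 * e$3"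
  define B where "B = lor_cross e v $ 3"
  note d = orthogonal_decomposition[OF assms(1,2), folded N_def B_def]
  have N0: "N \<noteq> 0"
    unfolding N_def by (metis add_pos_nonneg less_irrefl zero_le_square zero_less_one)
  have "N *\<^sub>R (lor_cross e v - \<epsilon> *\<^sub>R v) = (B - \<epsilon> * v$3) *\<^sub>R null_dir \<epsilon> e"
  proof -
    have "N * (lor_cross e v $ 1 - \<epsilon> * v$1) = (B - \<epsilon> * v$3) * (e$1 * e$3 - \<epsilon> * e$2)"
      using d(1,4) assms(3) by algebra
    moreover have "N * (lor_cross e v $ 2 - \<epsilon> * v$2) = (B - \<epsilon> * v$3) * (e$2 * e$3 + \<epsilon> * e$1)"
      using d(2,5) assms(3) by algebra
    moreover have "N * (lor_cross e v $ 3 - \<epsilon> * v$3) = (B - \<epsilon> * v$3) * N"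
      by (simp add: B_def)
    ultimately show ?thesis
      by (simp add: vec_eq_iff forall_3 null_dir_def flip: N_def)
  qed
  then have "N *\<^sub>R ((B + \<epsilon> * v$3) *\<^sub>R (lor_cross e v - \<epsilon> *\<^sub>R v))
      = (B + \<epsilon> * v$3) *\<^sub>R ((B - \<epsilon> * v$3) *\<^sub>R null_dir \<epsilon> e)"
    by (simp only: scaleR_left_commute[of N])
  also have "\<dots> = ((B + \<epsilon> * v$3) * (B - \<epsilon> * v$3)) *\<^sub>R null_dir \<epsilon> e"
    by (rule scaleR_scaleR)
  also have "(B + \<epsilon> * v$3) * (B - \<epsilon> * v$3) = B * B - (\<epsilon> * \<epsilon>) * (v$3 * v$3)"
    by (simp add: algebra_simps)
  also have "\<dots> = N * lor v v"
    using d(3) assms(3) by simp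
  also have "(N * lor v v) *\<^sub>R null_dir \<epsilon> e = N *\<^sub>R (lor v v *\<^sub>R null_dir \<epsilon> e)"
    by (rule scaleR_scaleR[symmetric])
  finally show ?thesis
    unfolding B_def by (rule scaleR_left_imp_eq[OF N0])
qed

lemma lightlike_third_nonzero:
  assumes "lor v v = 0" and "v \<noteq> 0"
  shows "v$3 \<noteq> 0"
proof
  assume "v$3 = 0"
  with assms(1) have "v$1 * v$1 + v$2 * v$2 = 0"
    by (simp add: lor_def)
  then have "v$1 = 0 \<and> v$2 = 0"
    by (simp add: sum_squares_eq_zero_iff)
  with \<open>v$3 = 0\<close> assms(2) show False
    by (simp add: vec_eq_iff forall_3)
qed

lemma lightlike_eigenvector:
  assumes "lor e e = 1" and "lor e v = 0" and "lor v v = 0" and "v \<noteq> 0"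
  obtains \<epsilon> where "\<epsilon> = 1 \<or> \<epsilon> = -1" and "lor_cross e v = \<epsilon> *\<^sub>R v"
proof -
  have "lor_cross e v $ 3 * lor_cross e v $ 3 = v$3 * v$3"
    using orthogonal_decomposition(3)[OF assms(1,2)] assms(3) by simp
  then have "lor_cross e v $ 3 = v$3 \<or> lor_cross e v $ 3 = - v$3"
    by (simp add: square_eq_iff)
  then obtain \<epsilon> :: real where \<epsilon>: "\<epsilon> = 1 \<or> \<epsilon> = -1" "lor_cross e v $ 3 = \<epsilon> * v$3"
    by (metis mult_1 mult_minus1)
  then have "(lor_cross e v $ 3 + \<epsilon> * v$3) *\<^sub>R (lor_cross e v - \<epsilon> *\<^sub>R v) = 0"
    using lor_cross_near_eigenvector[OF assms(1,2), of \<epsilon>] assms(3) by auto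
  moreover have "lor_cross e v $ 3 + \<epsilon> * v$3 \<noteq> 0"
    using \<epsilon> lightlike_third_nonzero[OF assms(3,4)] by auto
  ultimately have "lor_cross e v = \<epsilon> *\<^sub>R v"
    by simp
  with \<epsilon>(1) that show ?thesis by blast
qed

section \<open>Leading order of a function at a zero of finite order\<close>

text \<open>The sequence \<open>F\<close> plays the role of the successive derivatives of \<open>F 0\<close>. Each derivative that
  vanishes at \<open>a\<close> allows one application of l'Hopital's rule, which shifts the sequence by
  one.\<close>

lemma leading_taylor_quotient:
  fixes F :: "nat \<Rightarrow> real \<Rightarrow> real"
  assumes "open I" and "a \<in> I"
    and "\<And>n s. s \<in> I \<Longrightarrow> (F n has_real_derivative F (Suc n) s) (at s)"
    and "\<And>i. i < k \<Longrightarrow> F i a = 0"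
  shows "((\<lambda>s. F 0 s / (s - a) ^ k) \<longlongrightarrow> F k a / fact k) (at a)"
  using assms(3,4)
proof (induction k arbitrary: F)
  case 0
  have "(F 0 \<longlongrightarrow> F 0 a) (at a)"
    using DERIV_isCont[OF "0.prems"(1)[OF assms(2)]] by (simp add: isCont_def)
  then show ?case by simp
next
  case (Suc k)
  have nbhd: "\<forall>\<^sub>F s in at a. s \<in> I"
    using assms(1,2) by (simp add: eventually_at_in_open')
  have ih: "((\<lambda>s. F 1 s / (s - a) ^ k) \<longlongrightarrow> F (Suc k) a / fact k) (at a)"
    using Suc.IH[of "\<lambda>n. F (Suc n)"] Suc.prems by simp
  show ?case
  proof (rule lhopital)
    show "(F 0 \<longlongrightarrow> 0) (at a)"
      using DERIV_isCont[OF Suc.prems(1)[OF assms(2)], of 0] Suc.prems(2)[of 0]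
      by (simp add: isCont_def)
    show "((\<lambda>s. (s - a) ^ Suc k) \<longlongrightarrow> 0) (at a)"
      by (auto intro!: tendsto_eq_intros)
    show "\<forall>\<^sub>F s in at a. (s - a) ^ Suc k \<noteq> 0"
      using eventually_neq_at_within[of a a UNIV] by eventually_elim simp
    show "\<forall>\<^sub>F s in at a. real (Suc k) * (s - a) ^ k \<noteq> 0"
      using eventually_neq_at_within[of a a UNIV] by eventually_elim simp
    show "\<forall>\<^sub>F s in at a. (F 0 has_real_derivative F 1 s) (at s)"
      using nbhd by eventually_elim (use Suc.prems(1)[of _ 0] in simp)
    show "\<forall>\<^sub>F s in at a. ((\<lambda>s. (s - a) ^ Suc k) has_real_derivative real (Suc k) * (s - a) ^ k) (at s)"
      using DERIV_power_Suc[OF DERIV_diff[OF DERIV_ident DERIV_const[of a]]]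
      by (intro always_eventually allI) (simp add: add.commute)
    have "((\<lambda>s. F 1 s / (s - a) ^ k / real (Suc k)) \<longlongrightarrow> F (Suc k) a / fact k / real (Suc k)) (at a)"
      using ih by (rule tendsto_divide) auto
    then show "((\<lambda>s. F 1 s / (real (Suc k) * (s - a) ^ k)) \<longlongrightarrow> F (Suc k) a / fact (Suc k)) (at a)"
      by (simp add: mult.commute)
  qed
qed

text \<open>To leading order \<open>F 0\<close> is \<open>c (s - a)\<^sup>k\<close>, and \<open>F 1\<close> is
  \<open>k c (s - a)\<^sup>k\<^sup>-\<^sup>1\<close>, both by the preceding lemma.\<close>

lemma finite_order_zero_log_derivative:
  fixes F :: "nat \<Rightarrow> real \<Rightarrow> real"
  assumes "open I" and "a \<in> I"
    and der: "\<And>n s. s \<in> I \<Longrightarrow> (F n has_real_derivative F (Suc n) s) (at s)"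
    and "\<And>i. i < k \<Longrightarrow> F i a = 0" and "F k a \<noteq> 0" and "k \<ge> 1"
  shows "\<forall>\<^sub>F s in at a. F 0 s \<noteq> 0"
    and "((\<lambda>s. (s - a) * (F 1 s / F 0 s)) \<longlongrightarrow> real k) (at a)"
proof -
  have q0: "((\<lambda>s. F 0 s / (s - a) ^ k) \<longlongrightarrow> F k a / fact k) (at a)"
    using assms by (intro leading_taylor_quotient) auto
  have ne: "F k a / fact k \<noteq> 0"
    using assms(5) by simp
  show "\<forall>\<^sub>F s in at a. F 0 s \<noteq> 0"
    using tendsto_imp_eventually_ne[OF q0 ne] by eventually_elim auto
  obtain m where k: "k = Suc m"
    using assms(6) by (cases k) auto
  have q1: "((\<lambda>s. F 1 s / (s - a) ^ m) \<longlongrightarrow> F k a / fact m) (at a)"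
    using leading_taylor_quotient[of I a "\<lambda>n. F (Suc n)" m] assms(1-4) k by simp
  have "((\<lambda>s. (F 1 s / (s - a) ^ m) / (F 0 s / (s - a) ^ k)) \<longlongrightarrow> (F k a / fact m) / (F k a / fact k)) (at a)"
    using q1 q0 ne by (rule tendsto_divide)
  moreover have "(F k a / fact m) / (F k a / fact k) = real k"
    using assms(5) by (simp add: k field_simps)
  moreover have "\<forall>\<^sub>F s in at a. (F 1 s / (s - a) ^ m) / (F 0 s / (s - a) ^ k) = (s - a) * (F 1 s / F 0 s)"
    using eventually_neq_at_within[of a a UNIV] by eventually_elim (simp add: k)
  ultimately show "((\<lambda>s. (s - a) * (F 1 s / F 0 s)) \<longlongrightarrow> real k) (at a)"
    using Lim_transform_eventually by fastforce
qed

section \<open>Differentiating the causal curvature\<close>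

text \<open>To differentiate a function arbitrarily often it suffices to place it in a class of functions
  that is closed under taking derivatives. Members of the class represent the iterated
  derivatives on \<open>I\<close> only, since \<open>deriv\<close> is unrelated to the class elsewhere.\<close>

lemma iterated_deriv_in_class:
  fixes f :: "real \<Rightarrow> real"
  assumes "open I" and "P f"
    and step: "\<And>f. P f \<Longrightarrow> \<exists>g. P g \<and> (\<forall>s\<in>I. (f has_real_derivative g s) (at s))"
  shows "\<exists>g. P g \<and> (\<forall>s\<in>I. (deriv ^^ n) f s = g s)"
proof (induction n)
  case 0
  then show ?case using assms(2) by auto
next
  case (Suc n)
  then obtain g where g: "P g" "\<forall>s\<in>I. (deriv ^^ n) f s = g s" by blast
  obtain h where h: "P h" "\<forall>s\<in>I. (g has_real_derivative h s) (at s)"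
    using step[OF g(1)] by blast
  have "((deriv ^^ n) f has_real_derivative h s) (at s)" if "s \<in> I" for s
    using h(2)[rule_format, OF that] assms(1) that
    by (rule has_field_derivative_transform_within_open) (use g(2) in auto)
  then have "\<forall>s\<in>I. (deriv ^^ Suc n) f s = h s"
    by (auto intro: DERIV_imp_deriv)
  with h(1) show ?case by blast
qed

lemma iterated_deriv_has_derivative:
  fixes f :: "real \<Rightarrow> real"
  assumes "open I" and "P f"
    and step: "\<And>f. P f \<Longrightarrow> \<exists>g. P g \<and> (\<forall>s\<in>I. (f has_real_derivative g s) (at s))"
    and "s \<in> I"
  shows "((deriv ^^ n) f has_real_derivative (deriv ^^ Suc n) f s) (at s)"
proof -
  obtain g where g: "P g" "\<forall>s\<in>I. (deriv ^^ n) f s = g s"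
    using iterated_deriv_in_class[OF assms(1-3)] by blast
  obtain h where h: "\<forall>s\<in>I. (g has_real_derivative h s) (at s)"
    using step[OF g(1)] by blast
  have "((deriv ^^ n) f has_real_derivative h s) (at s)"
    using h[rule_format, OF assms(4)] assms(1,4)
    by (rule has_field_derivative_transform_within_open) (use g(2) in auto)
  then show ?thesis
    by (simp add: DERIV_imp_deriv)
qed

lemma has_real_derivative_lor:
  assumes "(f has_vector_derivative f') (at s)" and "(g has_vector_derivative g') (at s)"
  shows "((\<lambda>s. lor (f s) (g s)) has_real_derivative lor f' (g s) + lor (f s) g') (at s)"
proof -
  have "((\<lambda>s. h s $ i) has_real_derivative h' $ i) (at s)"
    if "(h has_vector_derivative h') (at s)" for h :: "real \<Rightarrow> real^3" and h' i
    using bounded_linear.has_vector_derivative[OF bounded_linear_vec_nth that]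
    by (simp add: has_real_derivative_iff_has_vector_derivative)
  note c = this[OF assms(1)] this[OF assms(2)]
  show ?thesis
    unfolding lor_def
    by (auto intro!: derivative_eq_intros c simp: algebra_simps)
qed

text \<open>By the product rule, sums of inner products of iterated derivatives of a curve form a
  class that is closed under derivatives. Using it to differentiate the causal curvature avoids the
  binomial coefficients of Leibniz' formula.\<close>

inductive lor_jet :: "(real \<Rightarrow> real^3) \<Rightarrow> (real \<Rightarrow> real) \<Rightarrow> bool" for \<gamma> where
  lor_jet_base: "lor_jet \<gamma> (\<lambda>s. lor ((vderiv ^^ i) \<gamma> s) ((vderiv ^^ j) \<gamma> s))"
| lor_jet_add: "lor_jet \<gamma> f \<Longrightarrow> lor_jet \<gamma> g \<Longrightarrow> lor_jet \<gamma> (\<lambda>s. f s + g s)"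

lemma smooth_curve_has_vector_derivative:
  assumes "smooth_curve_on I \<gamma>" and "s \<in> I"
  shows "((vderiv ^^ n) \<gamma> has_vector_derivative (vderiv ^^ Suc n) \<gamma> s) (at s)"
  using assms by (simp add: smooth_curve_on_def vderiv_def vector_derivative_works)

lemma lor_jet_derivative:
  assumes "smooth_curve_on I \<gamma>" and "lor_jet \<gamma> f"
  shows "\<exists>g. lor_jet \<gamma> g \<and> (\<forall>s\<in>I. (f has_real_derivative g s) (at s))"
  using assms(2)
proof induction
  case (lor_jet_base i j)
  have "lor_jet \<gamma> (\<lambda>s. lor ((vderiv ^^ Suc i) \<gamma> s) ((vderiv ^^ j) \<gamma> s)
                     + lor ((vderiv ^^ i) \<gamma> s) ((vderiv ^^ Suc j) \<gamma> s))"
    by (intro lor_jet.intros)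
  then show ?case
    using has_real_derivative_lor[OF smooth_curve_has_vector_derivative[OF assms(1)]
        smooth_curve_has_vector_derivative[OF assms(1)]] by blast
next
  case (lor_jet_add f g)
  then show ?case
    by (blast intro: lor_jet.lor_jet_add DERIV_add)
qed

lemma causal_curv_iterated_derivative:
  assumes "open I" and "smooth_curve_on I \<gamma>" and "s \<in> I"
  shows "((deriv ^^ n) (causal_curv \<gamma>) has_real_derivative (deriv ^^ Suc n) (causal_curv \<gamma>) s) (at s)"
proof (rule iterated_deriv_has_derivative[where P = "lor_jet \<gamma>", OF assms(1) _ _ assms(3)])
  have "causal_curv \<gamma> = (\<lambda>s. lor ((vderiv ^^ 2) \<gamma> s) ((vderiv ^^ 2) \<gamma> s))"
    by (simp add: causal_curv_def curv_vec_def fun_eq_iff numeral_2_eq_2)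
  then show "lor_jet \<gamma> (causal_curv \<gamma>)"
    by (simp add: lor_jet_base)
qed (rule lor_jet_derivative[OF assms(2)])

section \<open>The torsion near a lightlike point\<close>

text \<open>The derivative of the factor \<open>1 / curvature \<gamma>\<close> contributes a multiple of the curvature
  vector, which is orthogonal to the binormal, so only its existence matters.\<close>

lemma torsion_eq:
  assumes "(curv_vec \<gamma> has_vector_derivative v') (at s)"
    and "causal_curv \<gamma> differentiable (at s)" and "causal_curv \<gamma> s \<noteq> 0"
  shows "torsion \<gamma> s = - lor v' (lor_cross (tangent \<gamma> s) (curv_vec \<gamma> s)) / causal_curv \<gamma> s"
proof -
  let ?\<theta> = "causal_curv \<gamma>" and ?v = "curv_vec \<gamma> s" and ?J = "lor_cross (tangent \<gamma> s)"
  obtain d where d: "(?\<theta> has_real_derivative d) (at s)"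
    using assms(2) by (auto simp: real_differentiable_def)
  \<comment> \<open>As \<open>\<bar>\<theta>\<bar> = sqrt (\<theta> * \<theta>)\<close>, the chain rule applies without distinguishing the sign of \<open>\<theta>\<close>.\<close>
  have pos: "0 < ?\<theta> s * ?\<theta> s"
    using assms(3) not_real_square_gt_zero by blast
  note sqrt1 = DERIV_chain2[OF DERIV_real_sqrt[OF pos] DERIV_mult[OF d d]]
  have pos': "0 < sqrt (?\<theta> s * ?\<theta> s)"
    using pos by (rule real_sqrt_gt_zero)
  note sqrt2 = DERIV_chain2[OF DERIV_real_sqrt[OF pos'] sqrt1]
  have "sqrt (sqrt (?\<theta> s * ?\<theta> s)) \<noteq> 0"
    using pos' by simp
  from DERIV_inverse'[OF sqrt2 this]
  obtain c where "((\<lambda>s. inverse (sqrt (sqrt (?\<theta> s * ?\<theta> s)))) has_real_derivative c) (at s)"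
    by blast
  then have c: "((\<lambda>s. 1 / curvature \<gamma> s) has_real_derivative c) (at s)"
    by (simp add: curvature_def inverse_eq_divide)
  have "(normal_vec \<gamma> has_vector_derivative (1 / curvature \<gamma> s) *\<^sub>R v' + c *\<^sub>R ?v) (at s)"
    using has_vector_derivative_scaleR[OF c assms(1)]
    by (simp add: normal_vec_def[abs_def])
  then have n': "vderiv (normal_vec \<gamma>) s = (1 / curvature \<gamma> s) *\<^sub>R v' + c *\<^sub>R ?v"
    by (simp add: vderiv_def vector_derivative_at)
  have "torsion \<gamma> s = curve_sign \<gamma> s / (curvature \<gamma> s * curvature \<gamma> s) * lor v' (?J ?v)"
    by (simp add: torsion_def n' binormal_vec_def normal_vec_def lor_cross_scaleR_right
        lor_add_left lor_scaleR_left lor_scaleR_right lor_lor_cross_self)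
  also have "curve_sign \<gamma> s / (curvature \<gamma> s * curvature \<gamma> s) = - 1 / ?\<theta> s"
    using assms(3) by (auto simp: curve_sign_def curvature_def)
  finally show ?thesis by simp
qed

lemma not_bounded_of_pole:
  fixes f :: "real \<Rightarrow> real"
  assumes "((\<lambda>s. (s - a) * f s) \<longlongrightarrow> L) (at a)" and "L \<noteq> 0" and "\<forall>\<^sub>F s in at a. s \<in> S"
  shows "\<not> bounded (f ` S)"
proof
  assume "bounded (f ` S)"
  then obtain M where M: "\<And>s. s \<in> S \<Longrightarrow> norm (f s) \<le> M"
    by (auto simp: bounded_iff)
  have "Bfun f (at a)"
    by (rule BfunI[where K = M]) (use assms(3) M in \<open>auto elim: eventually_mono\<close>)
  moreover have "((\<lambda>s. s - a) \<longlongrightarrow> 0) (at a)"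
    by (auto intro!: tendsto_eq_intros)
  ultimately have "((\<lambda>s. (s - a) * f s) \<longlongrightarrow> 0) (at a)"
    using bounded_bilinear.Zfun_prod_Bfun[OF bounded_bilinear_mult]
    unfolding tendsto_Zfun_iff diff_zero by blast
  then show False
    using assms(1,2) tendsto_unique[OF at_neq_bot] by blast
qed

theorem theorem3p8:
  fixes \<gamma> :: "real \<Rightarrow> real^3" and I :: "real set" and s0 :: real and k :: nat
  assumes "k \<ge> 1"
    and "open I" and "is_interval I" and "s0 \<in> I"
    and "smooth_curve_on I \<gamma>"
    and "spacelike_curve_on I \<gamma>"
    and "arclength_param_on I \<gamma>"
    and "nonzero_curv_on I \<gamma>"
    and "type_L k \<gamma> s0"
  shows "(lor_cross (tangent \<gamma> s0) (curv_vec \<gamma> s0) = curv_vec \<gamma> s0 \<and>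
            ((\<lambda>s. (s - s0) * torsion \<gamma> s) \<longlongrightarrow> - (1/2) * real k) (at s0)
          \<or> lor_cross (tangent \<gamma> s0) (curv_vec \<gamma> s0) = - curv_vec \<gamma> s0 \<and>
            ((\<lambda>s. (s - s0) * torsion \<gamma> s) \<longlongrightarrow> (1/2) * real k) (at s0))
         \<and> torsion_unbounded_at I \<gamma> s0"
proof -
  define \<theta> where "\<theta> = causal_curv \<gamma>"
  define e where "e = tangent \<gamma>"
  define v where "v = curv_vec \<gamma>"
  define v' where "v' = vderiv v"
  have \<theta>_lor: "\<theta> s = lor (v s) (v s)" for s
    by (simp add: \<theta>_def v_def causal_curv_def)
  have e_der: "(e has_vector_derivative v s) (at s)" if "s \<in> I" for s
    using smooth_curve_has_vector_derivative[OF assms(5) that, of 1]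
    by (simp add: e_def v_def tangent_def curv_vec_def)
  have v_der: "(v has_vector_derivative v' s) (at s)" if "s \<in> I" for s
    using smooth_curve_has_vector_derivative[OF assms(5) that, of 2]
    by (simp add: v'_def v_def curv_vec_def numeral_2_eq_2)
  have v'_der: "(v' has_vector_derivative vderiv v' s) (at s)" if "s \<in> I" for s
    using smooth_curve_has_vector_derivative[OF assms(5) that, of 3]
    by (simp add: v'_def v_def curv_vec_def numeral_3_eq_3)
  have unit: "lor (e s) (e s) = 1" if "s \<in> I" for s
    using assms(7) that by (simp add: arclength_param_on_def e_def tangent_def)
  have orth: "lor (e s) (v s) = 0" if "s \<in> I" for s
  proof -
    have "((\<lambda>s. lor (e s) (e s)) has_real_derivative 0) (at s)"
      by (rule has_field_derivative_transform_within_open[OF DERIV_const[of 1] assms(2) that])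
        (simp add: unit)
    with has_real_derivative_lor[OF e_der[OF that] e_der[OF that]]
    have "lor (v s) (e s) + lor (e s) (v s) = 0"
      using DERIV_unique by blast
    then show ?thesis by (simp add: lor_commute)
  qed
  have \<theta>_der: "(\<theta> has_real_derivative 2 * lor (v' s) (v s)) (at s)" if "s \<in> I" for s
    using has_real_derivative_lor[OF v_der[OF that] v_der[OF that]]
    by (simp add: \<theta>_lor[abs_def] lor_commute)
  note \<theta>_iter = causal_curv_iterated_derivative[OF assms(2,5), folded \<theta>_def]
  have type: "\<And>i. i < k \<Longrightarrow> (deriv ^^ i) \<theta> s0 = 0" "(deriv ^^ k) \<theta> s0 \<noteq> 0"
    using assms(9) by (auto simp: type_L_def \<theta>_def)
  note log_der = finite_order_zero_log_derivative[of I s0 "\<lambda>n. (deriv ^^ n) \<theta>" k,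
      OF assms(2,4) \<theta>_iter type assms(1), simplified]
  have null0: "lor (v s0) (v s0) = 0"
    using type(1)[of 0] assms(1) by (simp add: \<theta>_lor)
  have v0: "v s0 \<noteq> 0"
    using assms(4,8) by (simp add: nonzero_curv_on_def v_def)
  obtain \<epsilon> where \<epsilon>: "\<epsilon> = 1 \<or> \<epsilon> = -1" and eig: "lor_cross (e s0) (v s0) = \<epsilon> *\<^sub>R v s0"
    using lightlike_eigenvector[OF unit orth null0 v0] assms(4) by metis
  then have \<epsilon>2: "\<epsilon> * \<epsilon> = 1" by auto

  \<comment> \<open>\<open>b\<close> is the factor of \<open>\<theta>\<close> that stays away from zero near \<open>s0\<close>, and \<open>R\<close> is the part of the
      torsion without a pole.\<close>
  define b where "b s = lor_cross (e s) (v s) $ 3 + \<epsilon> * v s $ 3" for s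
  define R where "R s = lor (v' s) (null_dir \<epsilon> (e s)) / b s" for s
  have cont: "continuous (at s0) e" "continuous (at s0) v" "continuous (at s0) v'"
    using assms(4) e_der v_der v'_der has_vector_derivative_continuous by blast+
  then have lim_nth: "((\<lambda>s. e s $ i) \<longlongrightarrow> e s0 $ i) (at s0)"
    "((\<lambda>s. v s $ i) \<longlongrightarrow> v s0 $ i) (at s0)" "((\<lambda>s. v' s $ i) \<longlongrightarrow> v' s0 $ i) (at s0)" for i
    by (auto simp: continuous_at intro: tendsto_vec_nth)
  have b0: "b s0 \<noteq> 0"
    using \<epsilon> lightlike_third_nonzero[OF null0 v0] by (auto simp: b_def eig)
  have b_lim: "(b \<longlongrightarrow> b s0) (at s0)"
    unfolding b_def lor_cross_components by (intro tendsto_intros lim_nth)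
  have R_lim: "(R \<longlongrightarrow> R s0) (at s0)"
    unfolding R_def lor_def null_dir_def vector_3
    by (intro tendsto_intros lim_nth b_lim b0)
  have near: "\<forall>\<^sub>F s in at s0. s \<in> I"
    using assms(2,4) by (simp add: eventually_at_in_open')
  have "\<forall>\<^sub>F s in at s0. torsion \<gamma> s = - \<epsilon> / 2 * (deriv \<theta> s / \<theta> s) - R s"
    using near log_der(1) tendsto_imp_eventually_ne[OF b_lim b0]
  proof eventually_elim
    case (elim s)
    have "b s *\<^sub>R (lor_cross (e s) (v s) - \<epsilon> *\<^sub>R v s) = \<theta> s *\<^sub>R null_dir \<epsilon> (e s)"
      unfolding b_def \<theta>_lor
      by (rule lor_cross_near_eigenvector[OF unit[OF elim(1)] orth[OF elim(1)] \<epsilon>2])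
    then have "b s * (lor (v' s) (lor_cross (e s) (v s)) - \<epsilon> * lor (v' s) (v s))
        = \<theta> s * lor (v' s) (null_dir \<epsilon> (e s))"
      by (metis lor_diff_right lor_scaleR_right)
    then have D: "lor (v' s) (lor_cross (e s) (v s)) = \<epsilon> * lor (v' s) (v s) + \<theta> s * R s"
      using elim(3) by (simp add: R_def field_simps)
    have "torsion \<gamma> s = - lor (v' s) (lor_cross (e s) (v s)) / \<theta> s"
      unfolding e_def v_def \<theta>_def
      by (rule torsion_eq)
        (use v_der[OF elim(1)] \<theta>_der[OF elim(1)] elim(2) in
          \<open>auto simp: v_def \<theta>_def real_differentiable_def\<close>)
    moreover have "deriv \<theta> s = 2 * lor (v' s) (v s)"
      by (rule DERIV_imp_deriv[OF \<theta>_der[OF elim(1)]])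
    ultimately show ?case
      using elim(2) by (simp add: D field_simps)
  qed
  then have "\<forall>\<^sub>F s in at s0. - \<epsilon> / 2 * ((s - s0) * (deriv \<theta> s / \<theta> s)) - (s - s0) * R s
      = (s - s0) * torsion \<gamma> s"
    by eventually_elim (simp only: right_diff_distrib mult.left_commute)
  moreover have "((\<lambda>s. - \<epsilon> / 2 * ((s - s0) * (deriv \<theta> s / \<theta> s)) - (s - s0) * R s)
      \<longlongrightarrow> - \<epsilon> / 2 * real k - (s0 - s0) * R s0) (at s0)"
    using log_der(2) by (intro tendsto_intros R_lim) simp_all
  ultimately have lim: "((\<lambda>s. (s - s0) * torsion \<gamma> s) \<longlongrightarrow> - \<epsilon> / 2 * real k) (at s0)"
    using Lim_transform_eventually by fastforce

  have "torsion_unbounded_at I \<gamma> s0"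
    unfolding torsion_unbounded_at_def
  proof (intro allI impI)
    fix \<delta> :: real
    assume "\<delta> > 0"
    then have "\<forall>\<^sub>F s in at s0. \<bar>s - s0\<bar> < \<delta> \<and> s \<noteq> s0"
      by (auto simp: eventually_at dist_real_def)
    with near log_der(1)
    have "\<forall>\<^sub>F s in at s0. s \<in> {s \<in> I. s \<noteq> s0 \<and> \<bar>s - s0\<bar> < \<delta> \<and> causal_curv \<gamma> s \<noteq> 0}"
      by eventually_elim (auto simp: \<theta>_def)
    then show "\<not> bounded (torsion \<gamma> ` {s \<in> I. s \<noteq> s0 \<and> \<bar>s - s0\<bar> < \<delta> \<and> causal_curv \<gamma> s \<noteq> 0})"
      by (rule not_bounded_of_pole[OF lim, rotated]) (use \<epsilon> assms(1) in auto)
  qed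
  with \<epsilon> eig lim show ?thesis
    unfolding e_def v_def by auto
qed

end
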